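(* Let $\phi$ be an analytic self-map of the upper half-plane $\mathbb{H}$ such that $$\phi(z)\longrightarrow\infty\qquad\text{and}\qquad\frac{\phi(z)}{z}\longrightarrow 1$$ as $z\to\infty$ non-tangentially, and which is of parabolic type I, i.e. the forward iterates have non-zero step. Assume also that $\phi$ admits a backward-iteration sequence $\{w_n\}_{n=0}^{\infty}$ tending to infinity, with bounded pseudo-hyperbolic steps $d_n=d(w_n,w_{n+1})\uparrow a<1$. Then $w_n$ must be of non-zero-height, i.e. $\operatorname{Im} w_n\downarrow\ell_\infty>0$.
   Context: $\mathbb{H}=\{z\in\mathbb{C}:\operatorname{Im} z>0\}$, and $d(z,w)=\left|\frac{w-z}{w-\overline{z}}\right|$ is the pseudo-hyperbolic distance on $\mathbb{H}$. "$z\to\infty$ non-tangentially" means that $z\to\infty$ within a sector $\{|\operatorname{Arg} z-\pi/2|<\theta_0\}$, for each $\theta_0\in(0,\pi/2)$. A backward-iteration sequence for $\phi$ is a sequence $\{w_n\}_{n\ge0}\subset\mathbb{H}$ with $\phi(w_{n+1})=w_n$ for all $n\ge 0$. $\uparrow$ and $\downarrow$ denote monotone (non-decreasing, resp. non-increasing) convergence. Type I: let $z_n=\phi_n(i)$, where $\phi_n$ is the $n$-th iterate of $\phi$. By Schwarz-Pick the step-lengths $s_n=d(z_n,z_{n+1})$ decrease to a limit $s_\infty\ge 0$. The map $\phi$ is of (parabolic) type I, or non-zero-step, if $s_\infty>0$. (This does not depend on the choice of $i$ as starting point.) *)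

theory Defs
  imports "HOL-Complex_Analysis.Complex_Analysis"
begin

definition upper_half_plane :: "complex set" where
  "upper_half_plane = {z. Im z > 0}"

definition pseudo_hyp_dist :: "complex \<Rightarrow> complex \<Rightarrow> real" where
  "pseudo_hyp_dist z w = cmod ((w - z) / (w - cnj z))"

(* Contained in the upper half-plane whenever theta <= pi/2: the point 0 and the
   non-positive-imaginary points satisfy |Arg z - pi/2| >= pi/2, as Arg 0 = 0. *)
definition vertical_sector :: "real \<Rightarrow> complex set" where
  "vertical_sector \<theta> = {z. \<bar>Arg z - pi / 2\<bar> < \<theta>}"

definition nontangential_limit_at_infinity ::
    "(complex \<Rightarrow> complex) \<Rightarrow> complex filter \<Rightarrow> bool" where
  "nontangential_limit_at_infinity f F \<longleftrightarrow>
     (\<forall>\<theta>. 0 < \<theta> \<and> \<theta> < pi / 2 \<longrightarrow>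
        filterlim f F (inf at_infinity (principal (vertical_sector \<theta>))))"

definition forward_step :: "(complex \<Rightarrow> complex) \<Rightarrow> nat \<Rightarrow> real" where
  "forward_step \<phi> n = pseudo_hyp_dist ((\<phi> ^^ n) \<i>) ((\<phi> ^^ Suc n) \<i>)"

(* For holomorphic self-maps of the upper half-plane the limit of the steps exists
   by Schwarz-Pick. *)
definition nonzero_step :: "(complex \<Rightarrow> complex) \<Rightarrow> bool" where
  "nonzero_step \<phi> \<longleftrightarrow> (\<exists>s>0. forward_step \<phi> \<longlonglongrightarrow> s)"

definition backward_iteration_sequence ::
    "(complex \<Rightarrow> complex) \<Rightarrow> (nat \<Rightarrow> complex) \<Rightarrow> bool" where
  "backward_iteration_sequence \<phi> w \<longleftrightarrow>
     (\<forall>n. w n \<in> upper_half_plane \<and> \<phi> (w (Suc n)) = w n)"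

end

theory Submission
  imports Defs
begin

text \<open>By the Julia lemma \<open>\<phi>\<close> does not decrease imaginary parts, so \<open>Im (w n)\<close> decreases. Since \<open>\<phi>\<close>
  is of type I, its iterates move a point by a hyperbolic distance of at least \<open>2 * ln R - O(1)\<close>
  in \<open>R\<close> steps. In a coordinate scaled to a far part of the backward orbit, \<open>\<phi>\<close> is nearly a
  translation by a bounded amount, so it moves points at relative height \<open>R\<close> by \<open>O(1)\<close> in \<open>R\<close>
  steps. Pushing such a point forward along the orbit gives a point \<open>P R\<close> whose distance to \<open>w 0\<close> is
  \<open>ln R + O(1)\<close> and whose distance to every \<open>w j\<close> is at most \<open>ln R + O(1)\<close> for large \<open>R\<close>, with a
  bound \<open>O(1)\<close> independent of \<open>j\<close>: all \<open>w j\<close> lie in one horoball at the limit of the \<open>P R\<close>. If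
  \<open>Im (w n)\<close> tended to \<open>0\<close>, that limit would be a finite real point and \<open>w\<close> would be bounded.\<close>

section \<open>Hyperbolic distance and orbits in the half-plane\<close>

lemma cmod_diff_cnj_sq:
  "(cmod (z - cnj w))\<^sup>2 = (cmod (z - w))\<^sup>2 + 4 * (Im z * Im w)"
  unfolding cmod_power2 by (simp add: power2_eq_square algebra_simps)

text \<open>This is \<open>4 * cosh (\<rho> / 2) ^ 2\<close> for the hyperbolic distance \<open>\<rho>\<close>, so the triangle
  inequality for \<open>\<rho>\<close> turns, up to constants, into submultiplicativity.\<close>

definition hyp_gap :: "complex \<Rightarrow> complex \<Rightarrow> real" where
  "hyp_gap z w = (cmod (z - cnj w))\<^sup>2 / (Im z * Im w)"

lemma hyp_gap_eq:
  assumes "Im z > 0" "Im w > 0"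
  shows "hyp_gap z w = 4 + (cmod (z - w))\<^sup>2 / (Im z * Im w)"
  using assms by (simp add: hyp_gap_def cmod_diff_cnj_sq field_simps)

lemma hyp_gap_ge_4: "Im z > 0 \<Longrightarrow> Im w > 0 \<Longrightarrow> hyp_gap z w \<ge> 4"
  by (simp add: hyp_gap_eq)

lemma hyp_gap_commute: "hyp_gap z w = hyp_gap w z"
proof -
  have "cmod (z - cnj w) = cmod (cnj (z - cnj w))" by (simp only: complex_mod_cnj)
  also have "\<dots> = cmod (w - cnj z)" by (simp add: norm_minus_commute)
  finally show ?thesis by (simp add: hyp_gap_def mult.commute)
qed

lemma pseudo_hyp_dist_sq_eq:
  assumes z: "Im z > 0" and w: "Im w > 0"
  shows "(pseudo_hyp_dist z w)\<^sup>2 * hyp_gap z w = (cmod (z - w))\<^sup>2 / (Im z * Im w)"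
proof -
  have "w - cnj z \<noteq> 0" using assms by (auto simp: complex_eq_iff)
  thus ?thesis
    by (subst hyp_gap_commute)
       (simp add: pseudo_hyp_dist_def hyp_gap_def norm_divide power_divide
          norm_minus_commute mult.commute)
qed

lemma Im_funpow_pos:
  assumes "\<And>z. Im z > 0 \<Longrightarrow> Im (f z) > 0" and "Im z > 0"
  shows "Im ((f ^^ n) z) > 0"
  using assms by (induction n) auto

lemma holomorphic_on_funpow:
  assumes "f holomorphic_on S" "f ` S \<subseteq> S"
  shows "(f ^^ n) holomorphic_on S"
proof (induction n)
  case (Suc n)
  have "(f ^^ n) ` S \<subseteq> S" using assms(2) by (induction n) auto
  then show ?case
    using holomorphic_on_compose[OF Suc holomorphic_on_subset[OF assms(1)]] by (simp add: o_def)
qed (simp add: id_def)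

lemma displacement_le:
  assumes dec: "decseq (\<lambda>n. Im (w n))" and C: "C \<ge> 0"
    and step: "\<And>n. cmod (w n - w (Suc n)) \<le> C * Im (w n)"
  shows "cmod (w (m + j) - w m) \<le> real j * C * Im (w m)"
proof (induction j)
  case (Suc j)
  have "cmod (w (m + Suc j) - w m) \<le> cmod (w (m + j) - w m) + cmod (w (m + j) - w (Suc (m + j)))"
    using norm_triangle_ineq4[of "w (m + j) - w m" "w (m + j) - w (Suc (m + j))"] by simp
  also have "\<dots> \<le> real j * C * Im (w m) + C * Im (w (m + j))"
    using Suc step by (intro add_mono)
  also have "C * Im (w (m + j)) \<le> C * Im (w m)"
    using C decseqD[OF dec, of m "m + j"] by (intro mult_left_mono) auto
  finally show ?case by (simp add: algebra_simps)
qed simp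

text \<open>This is \<open>cosh (x + y) = cosh x * cosh y + sinh x * sinh y\<close> with
  \<open>sinh\<close> bounded by \<open>cosh\<close>. The factor 2 so lost is exactly absorbed by
  the factor 4 in the normalisation of \<open>hyp_gap\<close>.\<close>

lemma hyp_gap_triangle:
  assumes z: "Im z > 0" and u: "Im u > 0" and w: "Im w > 0"
  shows "hyp_gap z w \<le> hyp_gap z u * hyp_gap u w"
proof -
  have less: "cmod (a - b) \<le> cmod (a - cnj b)" if "Im a > 0" "Im b > 0" for a b
    by (rule power2_le_imp_le) (use that in \<open>auto simp: cmod_diff_cnj_sq\<close>)
  \<comment> \<open>A Ptolemy-type identity for the points \<open>z\<close>, \<open>u\<close>,
    \<open>cnj u\<close>, \<open>cnj w\<close>.\<close>
  have "(z - cnj w) * (u - cnj u) = (z - cnj u) * (u - cnj w) - (z - u) * (cnj u - cnj w)"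
    by (simp add: algebra_simps)
  hence "cmod (z - cnj w) * cmod (u - cnj u)
      \<le> cmod (z - cnj u) * cmod (u - cnj w) + cmod (z - u) * cmod (cnj u - cnj w)"
    by (metis norm_mult norm_triangle_ineq4)
  also have "cmod (z - u) * cmod (cnj u - cnj w) \<le> cmod (z - cnj u) * cmod (u - cnj w)"
    using less[OF z u] less[OF u w]
    by (intro mult_mono) (auto simp flip: complex_cnj_diff)
  also have "cmod (u - cnj u) = 2 * Im u"
    using u by (simp add: complex_diff_cnj norm_mult)
  finally have "cmod (z - cnj w) * Im u \<le> cmod (z - cnj u) * cmod (u - cnj w)"
    by (simp add: mult.commute)
  hence "(cmod (z - cnj w) * Im u)\<^sup>2 \<le> (cmod (z - cnj u) * cmod (u - cnj w))\<^sup>2"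
    using u by (intro power_mono) auto
  thus ?thesis
    using z u w by (simp add: hyp_gap_def field_simps power2_eq_square)
qed

section \<open>Schwarz-Pick inequalities and the Julia lemma\<close>

text \<open>The Schwarz lemma conjugated by Cayley maps: \<open>C\<close> carries the disc to the
  half-plane with \<open>0\<close> going to \<open>w\<close>, and \<open>K\<close> carries the
  half-plane to the disc with \<open>f w\<close> going to \<open>0\<close>.\<close>

lemma Schwarz_Pick_cross:
  assumes hol: "f holomorphic_on upper_half_plane"
    and self: "\<And>z. Im z > 0 \<Longrightarrow> Im (f z) > 0"
    and z: "Im z > 0" and w: "Im w > 0"
  shows "cmod (f z - f w) * cmod (z - cnj w) \<le> cmod (z - w) * cmod (f z - cnj (f w))"
proof -
  define C where "C = (\<lambda>u. (w - cnj w * u) / (1 - u))"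
  define K where "K = (\<lambda>v. (v - f w) / (v - cnj (f w)))"
  have ne: "v - cnj u \<noteq> 0" if "Im v > 0" "Im u > 0" for u v
    using that by (auto simp: complex_eq_iff)
  have ImC: "Im (C u) > 0" if "cmod u < 1" for u
  proof -
    have u1: "1 - u \<noteq> 0" using that by auto
    have "Im (C u) = Im ((w - cnj w * u) * cnj (1 - u)) / (cmod (1 - u))\<^sup>2"
      unfolding C_def by (subst complex_div_cnj) (simp add: Im_divide_of_real)
    also have "Im ((w - cnj w * u) * cnj (1 - u)) = Im w * (1 - (cmod u)\<^sup>2)"
      unfolding cmod_power2 by (simp add: power2_eq_square algebra_simps)
    finally show ?thesis
      using that u1 w by (simp add: power_less_one_iff)
  qed
  have K1: "cmod (K v) < 1" if "Im v > 0" for v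
  proof -
    have "(cmod (v - f w))\<^sup>2 < (cmod (v - cnj (f w)))\<^sup>2"
      unfolding cmod_diff_cnj_sq using that self[OF w] by simp
    hence "cmod (v - f w) < cmod (v - cnj (f w))"
      by (rule power2_less_imp_less) simp
    thus ?thesis
      using ne[OF that self[OF w]] by (simp add: K_def norm_divide)
  qed
  define u where "u = (z - w) / (z - cnj w)"
  have zw: "z - cnj w \<noteq> 0" using ne[OF z w] .
  have u1: "cmod u < 1"
  proof -
    have "(cmod (z - w))\<^sup>2 < (cmod (z - cnj w))\<^sup>2"
      unfolding cmod_diff_cnj_sq using z w by simp
    hence "cmod (z - w) < cmod (z - cnj w)"
      by (rule power2_less_imp_less) simp
    thus ?thesis using zw by (simp add: u_def norm_divide)
  qed
  have Cu: "C u = z"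
  proof -
    have "1 - u = (w - cnj w) / (z - cnj w)"
      using zw by (simp add: u_def field_simps)
    moreover have "w - cnj w * u = z * (w - cnj w) / (z - cnj w)"
      using zw by (simp add: u_def field_simps)
    moreover have "w - cnj w \<noteq> 0" using ne[OF w w] .
    ultimately show ?thesis using zw by (simp add: C_def)
  qed
  have "cmod ((K \<circ> f \<circ> C) u) \<le> cmod u"
  proof (rule Schwarz_Lemma(1))
    have "C holomorphic_on ball 0 1"
      unfolding C_def by (intro holomorphic_intros) auto
    moreover have "f holomorphic_on C ` ball 0 1"
      using ImC by (intro holomorphic_on_subset[OF hol]) (auto simp: upper_half_plane_def)
    moreover have "K holomorphic_on (f \<circ> C) ` ball 0 1"
      unfolding K_def using ne[OF self[OF ImC] self[OF w]]
      by (intro holomorphic_intros) auto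
    ultimately show "(K \<circ> f \<circ> C) holomorphic_on ball 0 1"
      by (intro holomorphic_on_compose) (auto simp: comp_assoc image_comp)
    show "(K \<circ> f \<circ> C) 0 = 0" by (simp add: C_def K_def)
    show "cmod ((K \<circ> f \<circ> C) v) < 1" if "cmod v < 1" for v
      using K1[OF self[OF ImC[OF that]]] by simp
  qed (rule u1)
  hence "cmod ((f z - f w) / (f z - cnj (f w))) \<le> cmod ((z - w) / (z - cnj w))"
    by (simp add: Cu) (simp add: K_def u_def)
  thus ?thesis
    using zw ne[OF self[OF z] self[OF w]] by (simp add: norm_divide field_simps)
qed

text \<open>After squaring and expanding by \<open>cmod_diff_cnj_sq\<close>, the product of the two
  squared differences cancels. What remains has no denominators, so it still makes sense when
  \<open>f\<close> attains height 0.\<close>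

lemma Schwarz_Pick_sq:
  assumes hol: "f holomorphic_on upper_half_plane"
    and self: "\<And>z. Im z > 0 \<Longrightarrow> Im (f z) > 0"
    and z: "Im z > 0" and w: "Im w > 0"
  shows "(cmod (f z - f w))\<^sup>2 * (Im z * Im w) \<le> (cmod (z - w))\<^sup>2 * (Im (f z) * Im (f w))"
proof -
  have "(cmod (f z - f w) * cmod (z - cnj w))\<^sup>2 \<le> (cmod (z - w) * cmod (f z - cnj (f w)))\<^sup>2"
    by (intro power_mono Schwarz_Pick_cross assms mult_nonneg_nonneg norm_ge_zero)
  thus ?thesis
    by (simp add: power_mult_distrib cmod_diff_cnj_sq algebra_simps)
qed

lemma hyp_gap_contract:
  assumes "f holomorphic_on upper_half_plane"
    and self: "\<And>z. Im z > 0 \<Longrightarrow> Im (f z) > 0"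
    and z: "Im z > 0" and w: "Im w > 0"
  shows "hyp_gap (f z) (f w) \<le> hyp_gap z w"
  using Schwarz_Pick_sq[OF assms] z w self[OF z] self[OF w]
  by (simp add: hyp_gap_eq field_simps)

text \<open>The Julia lemma at infinity: Schwarz-Pick for \<open>z\<close> and \<open>\<i> * R\<close> as \<open>R\<close> tends to infinity.\<close>

lemma Im_ge_of_tendsto_div:
  assumes hol: "f holomorphic_on upper_half_plane"
    and self: "\<And>z. Im z > 0 \<Longrightarrow> Im (f z) > 0"
    and lim: "nontangential_limit_at_infinity (\<lambda>z. f z / z) (nhds 1)"
    and z: "Im z > 0"
  shows "Im (f z) \<ge> Im z"
proof -
  \<comment> \<open>These points climb the imaginary axis, which lies in every vertical sector, so
    the nontangential limit applies to them.\<close>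
  define v where "v = (\<lambda>n::nat. \<i> * of_real (real (Suc n)))"
  have v_inf: "filterlim v at_infinity sequentially"
  proof -
    have "filterlim (\<lambda>n. cmod (v n)) at_top sequentially"
      unfolding v_def norm_mult norm_of_real norm_ii
      by (simp add: filterlim_sequentially_Suc[of real] filterlim_real_sequentially
          del: of_nat_Suc)
    thus ?thesis by (rule filterlim_norm_at_top_imp_at_infinity)
  qed
  have Arg: "Arg (v n) = pi / 2" for n
  proof -
    have "Arg (v n) = Arg (of_real (real (Suc n)) * \<i>)" by (simp add: v_def mult.commute)
    also have "\<dots> = Arg \<i>" by (rule Arg_times_of_real) auto
    finally show ?thesis by simp
  qed
  have "filterlim v (inf at_infinity (principal (vertical_sector (pi/4)))) sequentially"
    unfolding filterlim_inf filterlim_principal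
    using v_inf by (simp add: vertical_sector_def Arg)
  moreover have "filterlim (\<lambda>z. f z / z) (nhds 1)
      (inf at_infinity (principal (vertical_sector (pi/4))))"
    using lim by (auto simp: nontangential_limit_at_infinity_def)
  ultimately have lim1: "(\<lambda>n. f (v n) / v n) \<longlonglongrightarrow> 1"
    using filterlim_compose by blast
  define t where "t = (\<lambda>n. inverse (real (Suc n)))"
  have t0: "t \<longlonglongrightarrow> 0" unfolding t_def by (rule LIMSEQ_inverse_real_of_nat)
  have v: "v n \<noteq> 0" "Im (v n) = real (Suc n)" "cmod (v n) = real (Suc n)" for n
    by (auto simp: v_def norm_mult simp del: of_nat_Suc)
  \<comment> \<open>Contraction of the gap, divided by the square of \<open>cmod (v n)\<close>. One
    factor \<open>Suc n\<close> cancels between \<open>Im (v n)\<close> and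
    \<open>Im (f (v n))\<close>, and every remaining term has a finite limit.\<close>
  have key: "(cmod (f z / v n - cnj (f (v n)) / v n))\<^sup>2 * Im z
      \<le> (cmod (z / v n - cnj (v n) / v n))\<^sup>2 * (Im (f z) * Im (\<i> * (f (v n) / v n)))" for n
  proof -
    have p: "Im (v n) > 0" by (simp add: v)
    have "hyp_gap (f z) (f (v n)) \<le> hyp_gap z (v n)"
      by (rule hyp_gap_contract[OF hol self z p])
    hence "(cmod (f z - cnj (f (v n))))\<^sup>2 * (Im z * Im (v n))
        \<le> (cmod (z - cnj (v n)))\<^sup>2 * (Im (f z) * Im (f (v n)))"
      using z p self[OF z] self[OF p] by (simp add: hyp_gap_def field_simps)
    moreover have "Im (f (v n)) = real (Suc n) * Im (\<i> * (f (v n) / v n))"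
    proof -
      have "\<i> * (f (v n) / v n) = f (v n) / of_real (real (Suc n))"
        by (simp add: v_def del: of_nat_Suc)
      thus ?thesis by (simp del: of_nat_Suc)
    qed
    ultimately have "real (Suc n) * ((cmod (f z - cnj (f (v n))))\<^sup>2 * Im z)
        \<le> real (Suc n) * ((cmod (z - cnj (v n)))\<^sup>2 * (Im (f z) * Im (\<i> * (f (v n) / v n))))"
      by (simp add: v mult_ac del: of_nat_Suc)
    hence "(cmod (f z - cnj (f (v n))))\<^sup>2 * Im z
        \<le> (cmod (z - cnj (v n)))\<^sup>2 * (Im (f z) * Im (\<i> * (f (v n) / v n)))"
      by (rule mult_left_le_imp_le) simp
    hence "(cmod (f z - cnj (f (v n))))\<^sup>2 * Im z / (real (Suc n))\<^sup>2
        \<le> (cmod (z - cnj (v n)))\<^sup>2 * (Im (f z) * Im (\<i> * (f (v n) / v n))) / (real (Suc n))\<^sup>2"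
      by (rule divide_right_mono) simp
    thus ?thesis
      by (simp only: diff_divide_distrib[symmetric] norm_divide power_divide v times_divide_eq_left)
  qed
  have zv: "(\<lambda>n. c / v n) \<longlonglongrightarrow> 0" for c
    using v_inf by (intro tendsto_divide_0[OF tendsto_const])
  have cv: "cnj (v n) / v n = -1" for n
    by (simp add: v_def del: of_nat_Suc)
  have cf: "cnj (f (v n)) / v n = - cnj (f (v n) / v n)" for n
    by (simp add: v_def del: of_nat_Suc)
  have "(\<lambda>n. (cmod (f z / v n - cnj (f (v n)) / v n))\<^sup>2 * Im z)
      \<longlonglongrightarrow> (cmod (0 - - cnj 1))\<^sup>2 * Im z"
    unfolding cf by (intro tendsto_intros zv lim1)
  moreover have "(\<lambda>n. (cmod (z / v n - cnj (v n) / v n))\<^sup>2 * (Im (f z) * Im (\<i> * (f (v n) / v n))))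
      \<longlonglongrightarrow> (cmod (0 - (-1)))\<^sup>2 * (Im (f z) * Im (\<i> * 1))"
    unfolding cv by (intro tendsto_intros zv lim1)
  ultimately have "(cmod (0 - - cnj 1))\<^sup>2 * Im z \<le> (cmod (0 - (-1)))\<^sup>2 * (Im (f z) * Im (\<i> * 1))"
    using key by (intro LIMSEQ_le) auto
  thus ?thesis by simp
qed

text \<open>Apply the strict version to \<open>f + \<i> * e\<close> and let \<open>e\<close> tend to
  0. The closed version is meant for displacements such as \<open>\<lambda>z. f z - z\<close>, whose
  imaginary part is nonnegative by the Julia lemma but may vanish.\<close>

lemma Schwarz_Pick_sq_closed:
  assumes hol: "f holomorphic_on upper_half_plane"
    and self: "\<And>z. Im z > 0 \<Longrightarrow> Im (f z) \<ge> 0"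
    and z: "Im z > 0" and w: "Im w > 0"
  shows "(cmod (f z - f w))\<^sup>2 * (Im z * Im w) \<le> (cmod (z - w))\<^sup>2 * (Im (f z) * Im (f w))"
proof -
  have "(cmod (f z - f w))\<^sup>2 * (Im z * Im w)
      \<le> (cmod (z - w))\<^sup>2 * ((Im (f z) + e) * (Im (f w) + e))" if "e > 0" for e
  proof -
    have "(cmod ((f z + \<i> * of_real e) - (f w + \<i> * of_real e)))\<^sup>2 * (Im z * Im w)
        \<le> (cmod (z - w))\<^sup>2 * (Im (f z + \<i> * of_real e) * Im (f w + \<i> * of_real e))"
      by (rule Schwarz_Pick_sq[of "\<lambda>z. f z + \<i> * of_real e"])
         (use hol z w that in \<open>auto intro!: holomorphic_intros add_nonneg_pos self\<close>)
    thus ?thesis by simp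
  qed
  hence "eventually (\<lambda>e. (cmod (f z - f w))\<^sup>2 * (Im z * Im w)
      \<le> (cmod (z - w))\<^sup>2 * ((Im (f z) + e) * (Im (f w) + e))) (at_right 0)"
    by (auto simp: eventually_at_right_field intro!: exI[of _ 1])
  moreover have "((\<lambda>e. (cmod (z - w))\<^sup>2 * ((Im (f z) + e) * (Im (f w) + e)))
      \<longlongrightarrow> (cmod (z - w))\<^sup>2 * ((Im (f z) + 0) * (Im (f w) + 0))) (at_right 0)"
    by (intro tendsto_intros)
  ultimately show ?thesis
    using tendsto_lowerbound[of _ _ "at_right (0::real)"] by force
qed

lemma Im_funpow_ge:
  assumes self: "\<And>z. Im z > 0 \<Longrightarrow> Im (f z) > 0"
    and inc: "\<And>z. Im z > 0 \<Longrightarrow> Im (f z) \<ge> Im z" and "Im z > 0"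
  shows "Im ((f ^^ n) z) \<ge> Im z"
proof (induction n)
  case (Suc n)
  have "Im ((f ^^ n) z) > 0" by (rule Im_funpow_pos[OF self \<open>Im z > 0\<close>])
  with Suc inc show ?case by (auto intro: order_trans)
qed simp

section \<open>Quadratic growth of the gap along forward orbits\<close>

text \<open>With \<open>1 + e\<close> written as \<open>(1 + d)^2\<close>, Bernoulli makes
  \<open>(1 + d) ^ q\<close> at least linear in \<open>q\<close>, and squaring gives the quadratic
  bound. Monotonicity covers the indices between multiples of \<open>k\<close>.\<close>

lemma geometric_growth_ge_square:
  fixes y :: "nat \<Rightarrow> real"
  assumes pos: "y 0 > 0" and mono: "incseq y" and k: "k \<ge> 1" and e: "e > 0"
    and grow: "\<And>m. y (m + k) \<ge> (1 + e) * y m"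
  shows "\<exists>c>0. \<forall>m. y m \<ge> c * (real m)\<^sup>2"
proof -
  define d where "d = sqrt (1 + e) - 1"
  have d: "d > 0" using e by (simp add: d_def)
  \<comment> \<open>The bound by 1 pays for the incomplete last block, the bound by \<open>d\<close>
    for the complete ones.\<close>
  define \<eta> where "\<eta> = min 1 d"
  have \<eta>: "\<eta> > 0" "\<eta> \<le> 1" "\<eta> \<le> d" using d by (auto simp: \<eta>_def)
  have pw: "y (q * k) \<ge> (1 + e) ^ q * y 0" for q
  proof (induction q)
    case (Suc q)
    have "(1 + e) ^ Suc q * y 0 \<le> (1 + e) * y (q * k)"
      using Suc e by (simp add: mult.assoc mult_left_mono)
    also have "\<dots> \<le> y (Suc q * k)" using grow[of "q * k"] by (simp add: add.commute)
    finally show ?case .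
  qed simp
  have "y m \<ge> y 0 * (\<eta> / k)\<^sup>2 * (real m)\<^sup>2" for m
  proof -
    define q where "q = m div k"
    have "m = q * k + m mod k" by (simp add: q_def)
    moreover have "m mod k < k" using k by simp
    ultimately have "m \<le> k * (q + 1)" by (simp add: algebra_simps)
    hence m: "real m \<le> real k * (real q + 1)"
      by (metis of_nat_1 of_nat_add of_nat_le_iff of_nat_mult)
    have "\<eta> / k * real m \<le> \<eta> / k * (real k * (real q + 1))"
      using \<eta> k m by (intro mult_left_mono) auto
    also have "\<dots> = \<eta> * real q + \<eta>" using k by (simp add: algebra_simps)
    also have "\<dots> \<le> 1 + real q * d"
      using \<eta> mult_left_mono[of \<eta> d "real q"] by (simp add: mult.commute)
    also have "\<dots> \<le> (1 + d) ^ q" using d by (intro Bernoulli_inequality) auto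
    finally have "(\<eta> / k * real m)\<^sup>2 \<le> ((1 + d) ^ q)\<^sup>2"
      using \<eta> by (intro power_mono) auto
    also have "\<dots> = ((1 + d)\<^sup>2) ^ q" by (simp add: power_mult[symmetric] mult.commute)
    also have "(1 + d)\<^sup>2 = 1 + e" using e by (simp add: d_def)
    finally have "y 0 * (\<eta> / k * real m)\<^sup>2 \<le> y 0 * (1 + e) ^ q"
      using pos by (intro mult_left_mono) auto
    also have "\<dots> \<le> y (q * k)" using pw[of q] by (simp add: mult.commute)
    also have "\<dots> \<le> y m" using mono by (rule incseqD) (simp add: q_def)
    finally show ?thesis by (simp add: power_mult_distrib power_divide mult_ac)
  qed
  moreover have "y 0 * (\<eta> / k)\<^sup>2 > 0" using pos \<eta> k by simp
  ultimately show ?thesis by blast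
qed

text \<open>Where the heights grow by a factor at most \<open>1 + e\<close>, the increments of the orbit are values
  of \<open>\<lambda>z. f z - z\<close> with small imaginary part, so by Schwarz-Pick they hardly vary and add up.\<close>

lemma orbit_displacement_ge:
  assumes hol: "f holomorphic_on upper_half_plane"
    and self: "\<And>z. Im z > 0 \<Longrightarrow> Im (f z) > 0"
    and inc: "\<And>z. Im z > 0 \<Longrightarrow> Im (f z) \<ge> Im z"
    and orbit: "\<And>n. z (Suc n) = f (z n)" and pos: "Im (z 0) > 0"
    and upper: "\<And>n. (cmod (z n - z (Suc n)))\<^sup>2 \<le> U\<^sup>2 * (Im (z n) * Im (z (Suc n)))"
    and lower: "\<And>n. s\<^sup>2 * (Im (z n) * Im (z (Suc n))) \<le> (cmod (z n - z (Suc n)))\<^sup>2"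
    and U: "U \<ge> 0" and s: "s > 0" and e: "e \<ge> 0" "2 * real k * e * U \<le> s"
    and window: "Im (z k) \<le> (1 + e) * Im (z 0)"
  shows "cmod (z k - z 0) \<ge> real k * s * Im (z 0) / 2"
proof -
  define p where "p = (\<lambda>n. z (Suc n) - z n)"
  define y where "y = Im (z 0)"
  have zpos: "Im (z n) > 0" for n
    by (induction n) (use pos self orbit in auto)
  have mono: "incseq (\<lambda>n. Im (z n))"
    using inc[OF zpos] by (intro incseq_SucI) (simp add: orbit)
  have Imp: "0 \<le> Im (p n)" "n < k \<Longrightarrow> Im (p n) \<le> e * y" for n
  proof -
    show "0 \<le> Im (p n)" using incseq_SucD[OF mono, of n] by (simp add: p_def)
    assume "n < k"
    hence "Im (z (Suc n)) \<le> Im (z k)" using incseqD[OF mono, of "Suc n" k] by simp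
    moreover have "Im (z 0) \<le> Im (z n)" using incseqD[OF mono, of 0 n] by simp
    ultimately show "Im (p n) \<le> e * y"
      using window by (simp add: p_def y_def algebra_simps)
  qed
  have step: "cmod (p (Suc n) - p n) \<le> U * e * y" if "Suc n < k" for n
  proof -
    have "(cmod ((f (z n) - z n) - (f (z (Suc n)) - z (Suc n))))\<^sup>2 * (Im (z n) * Im (z (Suc n)))
        \<le> (cmod (z n - z (Suc n)))\<^sup>2 * (Im (f (z n) - z n) * Im (f (z (Suc n)) - z (Suc n)))"
      \<comment> \<open>The displacement map sends the half-plane into its closure, by
        \<open>inc\<close>.\<close>
      by (rule Schwarz_Pick_sq_closed[of "\<lambda>z. f z - z"])
         (use hol inc zpos in \<open>auto intro!: holomorphic_intros\<close>)
    hence "(cmod (p n - p (Suc n)))\<^sup>2 * (Im (z n) * Im (z (Suc n)))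
        \<le> (cmod (z n - z (Suc n)))\<^sup>2 * (Im (p n) * Im (p (Suc n)))"
      by (simp only: p_def orbit)
    also have "\<dots> \<le> (U\<^sup>2 * (Im (z n) * Im (z (Suc n)))) * ((e * y) * (e * y))"
      using that Imp[of n] Imp[of "Suc n"] upper[of n] U zpos[of n] zpos[of "Suc n"]
      by (intro mult_mono) auto
    finally have "(cmod (p n - p (Suc n)))\<^sup>2 * (Im (z n) * Im (z (Suc n)))
        \<le> (U * e * y)\<^sup>2 * (Im (z n) * Im (z (Suc n)))"
      by (simp add: power2_eq_square mult_ac)
    hence "(cmod (p n - p (Suc n)))\<^sup>2 \<le> (U * e * y)\<^sup>2"
      by (rule mult_right_le_imp_le) (use zpos in auto)
    moreover have "U * e * y \<ge> 0" using U e pos by (simp add: y_def)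
    ultimately show ?thesis
      by (simp add: norm_minus_commute power2_le_iff_abs_le)
  qed
  have near: "cmod (p n - p 0) \<le> real n * (U * e * y)" if "n < k" for n
    using that
  proof (induction n)
    case (Suc n)
    have "cmod (p (Suc n) - p 0) \<le> cmod (p (Suc n) - p n) + cmod (p n - p 0)"
      using norm_triangle_ineq[of "p (Suc n) - p n" "p n - p 0"] by simp
    also have "\<dots> \<le> U * e * y + real n * (U * e * y)"
      using step[of n] Suc by (intro add_mono) auto
    finally show ?case by (simp add: algebra_simps)
  qed simp
  have y0: "y > 0" using pos by (simp add: y_def)
  have p0: "cmod (p 0) \<ge> s * y"
  proof -
    have "(s * y)\<^sup>2 \<le> s\<^sup>2 * (Im (z 0) * Im (z (Suc 0)))"
      using incseq_SucD[OF mono, of 0] y0 s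
      by (simp add: y_def power2_eq_square mult_left_mono)
    also have "\<dots> \<le> (cmod (p 0))\<^sup>2" using lower[of 0] by (simp add: p_def norm_minus_commute)
    finally show ?thesis by (rule power2_le_imp_le) simp
  qed
  have "z k - z 0 = (\<Sum>n<k. p n)" by (simp add: p_def sum_lessThan_telescope)
  also have "\<dots> = of_nat k * p 0 + (\<Sum>n<k. p n - p 0)" by (simp add: sum_subtractf)
  finally have "cmod (of_nat k * p 0) \<le> cmod (z k - z 0) + cmod (\<Sum>n<k. p n - p 0)"
    by (metis add_diff_cancel_right' norm_triangle_ineq4)
  moreover have "cmod (\<Sum>n<k. p n - p 0) \<le> real k * (real k * (U * e * y))"
  proof -
    have "cmod (\<Sum>n<k. p n - p 0) \<le> (\<Sum>n<k. real k * (U * e * y))"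
    proof (rule sum_norm_le)
      fix n assume "n \<in> {..<k}"
      hence "cmod (p n - p 0) \<le> real n * (U * e * y)" by (intro near) simp
      also have "\<dots> \<le> real k * (U * e * y)"
        using \<open>n \<in> {..<k}\<close> U e y0 by (intro mult_right_mono) auto
      finally show "cmod (p n - p 0) \<le> real k * (U * e * y)" .
    qed
    thus ?thesis by simp
  qed
  \<comment> \<open>The assumption \<open>2 * real k * e * U \<le> s\<close> keeps the total
    deviation from \<open>k\<close> equal increments within half of the main term.\<close>
  moreover have "real k * (real k * (U * e * y)) \<le> real k * (s / 2 * y)"
    using e y0 by (intro mult_left_mono) (auto simp: mult_ac)
  moreover have "real k * (s * y) \<le> cmod (of_nat k * p 0)"
    using p0 by (simp add: norm_mult mult_left_mono)
  ultimately show ?thesis by (simp add: y_def algebra_simps)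
qed

text \<open>Either heights grow geometrically over some fixed block length, which is more than
  enough, or for every \<open>k\<close> some \<open>k\<close> consecutive steps have almost constant
  height. There the nonzero step forces a displacement linear in \<open>k\<close> relative to the
  height, and since gaps shrink along the orbit the bound also holds at its start.\<close>

lemma forward_gap_ge_square:
  assumes hol: "f holomorphic_on upper_half_plane"
    and self: "\<And>z. Im z > 0 \<Longrightarrow> Im (f z) > 0"
    and inc: "\<And>z. Im z > 0 \<Longrightarrow> Im (f z) \<ge> Im z"
    and step: "nonzero_step f"
  shows "\<exists>c>0. \<forall>k. hyp_gap \<i> ((f ^^ k) \<i>) \<ge> c * (real k)\<^sup>2"
proof -
  define z where "z = (\<lambda>n. (f ^^ n) \<i>)"
  have z0: "z 0 = \<i>" and zS: "z (Suc n) = f (z n)" for n by (auto simp: z_def)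
  have zpos: "Im (z n) > 0" for n unfolding z_def by (rule Im_funpow_pos[OF self]) auto
  have mono: "incseq (\<lambda>n. Im (z n))"
    using inc[OF zpos] by (intro incseq_SucI) (simp add: zS)
  have z1: "Im (z n) \<ge> 1" for n using incseqD[OF mono, of 0 n] by (simp add: z0)
  have dec: "decseq (\<lambda>m. hyp_gap (z m) (z (m + k)))" for k
    by (intro decseq_SucI) (simp add: zS hyp_gap_contract[OF hol self zpos zpos])
  show ?thesis
  proof (cases "\<exists>k\<ge>1. \<exists>e>0. \<forall>m. Im (z (m + k)) \<ge> (1 + e) * Im (z m)")
    case True
    then obtain k e where "k \<ge> 1" "e > 0" "\<And>m. Im (z (m + k)) \<ge> (1 + e) * Im (z m)" by blast
    with geometric_growth_ge_square[OF _ mono, of k e] zpos[of 0]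
    obtain c where c: "c > 0" "\<And>m. Im (z m) \<ge> c * (real m)\<^sup>2" by blast
    have "hyp_gap \<i> (z m) \<ge> c * (real m)\<^sup>2" for m
    proof -
      have "(Im (z m))\<^sup>2 \<le> (1 + Im (z m))\<^sup>2" using zpos[of m] by (intro power_mono) auto
      also have "\<dots> \<le> (cmod (\<i> - cnj (z m)))\<^sup>2" by (simp add: cmod_power2)
      finally have "Im (z m) \<le> hyp_gap \<i> (z m)"
        using zpos[of m] by (simp add: hyp_gap_def pos_le_divide_eq power2_eq_square)
      with c(2)[of m] show ?thesis by linarith
    qed
    with c(1) show ?thesis by (auto simp: z_def)
  next
    case False
    obtain s where s: "s > 0" "forward_step f \<longlonglongrightarrow> s"
      using step by (auto simp: nonzero_step_def)
    define g where "g = (\<lambda>m. hyp_gap (z m) (z (Suc m)))"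
    have g: "g m * (Im (z m) * Im (z (Suc m))) =
        4 * (Im (z m) * Im (z (Suc m))) + (cmod (z m - z (Suc m)))\<^sup>2" for m
      using zpos[of m] zpos[of "Suc m"] by (simp add: g_def hyp_gap_eq field_simps)
    have g4: "g m \<ge> 4" for m unfolding g_def by (intro hyp_gap_ge_4 zpos)
    have gdec: "decseq g" using dec[of 1] by (simp add: g_def)
    have glow: "g m \<ge> 4 + s\<^sup>2" for m
    proof -
      \<comment> \<open>Half of the limit suffices: multiplied by \<open>g n \<ge> 4\<close>, the
        square of \<open>s / 2\<close> gives back \<open>s^2\<close>. As \<open>g\<close> decreases,
        a bound at late indices holds at all of them.\<close>
      have "eventually (\<lambda>n. forward_step f n > s / 2) sequentially"
        using s by (intro order_tendstoD) auto
      then obtain N where N: "\<And>n. n \<ge> N \<Longrightarrow> forward_step f n > s / 2"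
        by (auto simp: eventually_sequentially)
      define n where "n = max N m"
      have "(s / 2)\<^sup>2 \<le> (pseudo_hyp_dist (z n) (z (Suc n)))\<^sup>2"
        using N[of n] s by (intro power_mono) (auto simp: forward_step_def z_def n_def)
      hence "(s / 2)\<^sup>2 * 4 \<le> (pseudo_hyp_dist (z n) (z (Suc n)))\<^sup>2 * g n"
        using g4[of n] by (intro mult_mono) auto
      also have "\<dots> = g n - 4"
        using pseudo_hyp_dist_sq_eq[OF zpos zpos, of n "Suc n"] hyp_gap_eq[OF zpos zpos, of n "Suc n"]
        by (simp add: g_def)
      also have "g n \<le> g m" using gdec by (rule decseqD) (simp add: n_def)
      finally show ?thesis by (simp add: power_divide)
    qed
    define U where "U = sqrt (g 0 - 4)"
    have U: "U \<ge> 0" "U\<^sup>2 = g 0 - 4" using g4[of 0] by (auto simp: U_def)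
    have upper: "(cmod (z n - z (Suc n)))\<^sup>2 \<le> U\<^sup>2 * (Im (z n) * Im (z (Suc n)))" for n
    proof -
      have "g n * (Im (z n) * Im (z (Suc n))) \<le> g 0 * (Im (z n) * Im (z (Suc n)))"
        using decseqD[OF gdec, of 0 n] zpos by (intro mult_right_mono) (auto simp: less_imp_le)
      thus ?thesis using g[of n] by (simp add: U(2) algebra_simps)
    qed
    have lower: "s\<^sup>2 * (Im (z n) * Im (z (Suc n))) \<le> (cmod (z n - z (Suc n)))\<^sup>2" for n
    proof -
      have "(4 + s\<^sup>2) * (Im (z n) * Im (z (Suc n))) \<le> g n * (Im (z n) * Im (z (Suc n)))"
        using glow[of n] zpos by (intro mult_right_mono) (auto simp: less_imp_le)
      thus ?thesis using g[of n] by (simp add: algebra_simps)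
    qed
    have "hyp_gap \<i> (z k) \<ge> s\<^sup>2 / 8 * (real k)\<^sup>2" for k
    proof (cases "k = 0")
      case True
      thus ?thesis using hyp_gap_ge_4[of \<i> "z 0"] zpos[of 0] by simp
    next
      case k: False
      \<comment> \<open>The cap 1 keeps the height ratio below 2; the other term meets the smallness
        condition of \<open>orbit_displacement_ge\<close>, with \<open>U + 1\<close> in case
        \<open>U\<close> is 0.\<close>
      define e where "e = min 1 (s / (2 * real k * (U + 1)))"
      have e: "e > 0" "e \<le> 1" using s U(1) k by (auto simp: e_def)
      have "2 * real k * e * U \<le> 2 * real k * e * (U + 1)"
        using e by (intro mult_left_mono) auto
      also have "\<dots> \<le> s"
      proof -
        have "e \<le> s / (2 * real k * (U + 1))" by (simp add: e_def)
        moreover have "2 * real k * (U + 1) > 0" using k U(1) by simp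
        ultimately show ?thesis by (simp add: pos_le_divide_eq mult_ac)
      qed
      finally have eU: "2 * real k * e * U \<le> s" .
      have "k \<ge> 1" using k by simp
      with False e obtain m where m: "Im (z (m + k)) < (1 + e) * Im (z m)"
        by (meson not_less)
      have "cmod (z (m + k) - z (m + 0)) \<ge> real k * s * Im (z (m + 0)) / 2"
        by (rule orbit_displacement_ge[OF hol self inc, of "\<lambda>n. z (m + n)" U s e k])
           (use upper lower U s e eU m zpos zS in auto)
      hence "(real k * s * Im (z m) / 2)\<^sup>2 \<le> (cmod (z m - z (m + k)))\<^sup>2"
        using s zpos[of m] by (intro power_mono) (auto simp: norm_minus_commute less_imp_le)
      moreover have "Im (z m) * Im (z (m + k)) \<le> 2 * (Im (z m))\<^sup>2"
      proof -
        have "(1 + e) * Im (z m) \<le> 2 * Im (z m)"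
          using e zpos[of m] by (intro mult_right_mono) auto
        with m have "Im (z (m + k)) \<le> 2 * Im (z m)" by linarith
        hence "Im (z m) * Im (z (m + k)) \<le> Im (z m) * (2 * Im (z m))"
          using zpos[of m] by (intro mult_left_mono) auto
        thus ?thesis by (simp add: power2_eq_square)
      qed
      ultimately have "(real k * s * Im (z m) / 2)\<^sup>2 / (2 * (Im (z m))\<^sup>2)
          \<le> (cmod (z m - z (m + k)))\<^sup>2 / (Im (z m) * Im (z (m + k)))"
        using zpos[of m] zpos[of "m + k"] by (intro frac_le) auto
      also have "\<dots> \<le> hyp_gap (z m) (z (m + k))" using zpos by (simp add: hyp_gap_eq)
      also have "\<dots> \<le> hyp_gap (z 0) (z (0 + k))" by (rule decseqD[OF dec]) simp
      also have "(real k * s * Im (z m) / 2)\<^sup>2 / (2 * (Im (z m))\<^sup>2) = s\<^sup>2 / 8 * (real k)\<^sup>2"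
        using zpos[of m] by (simp add: power_mult_distrib power_divide)
      finally show ?thesis by (simp add: z0)
    qed
    moreover have "s\<^sup>2 / 8 > 0" using s by simp
    ultimately show ?thesis unfolding z_def by blast
  qed
qed

text \<open>Changing the base point costs two factors \<open>G\<close>: one from \<open>\<i>\<close>
  to \<open>z\<close>, and one between their images, which \<open>f ^^ k\<close> does not move
  further apart.\<close>

lemma orbit_gap_ge_square:
  assumes hol: "f holomorphic_on upper_half_plane"
    and self: "\<And>z. Im z > 0 \<Longrightarrow> Im (f z) > 0"
    and inc: "\<And>z. Im z > 0 \<Longrightarrow> Im (f z) \<ge> Im z"
    and step: "nonzero_step f" and z: "Im z > 0"
  shows "\<exists>b>0. \<forall>k. hyp_gap z ((f ^^ k) z) \<ge> (b * real k)\<^sup>2"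
proof -
  obtain c where c: "c > 0" "\<And>k. hyp_gap \<i> ((f ^^ k) \<i>) \<ge> c * (real k)\<^sup>2"
    using forward_gap_ge_square[OF hol self inc step] by blast
  define G where "G = hyp_gap \<i> z"
  have G: "G > 0" using hyp_gap_ge_4[of \<i> z] z by (simp add: G_def)
  have "hyp_gap z ((f ^^ k) z) \<ge> (sqrt c / G * real k)\<^sup>2" for k
  proof -
    have holk: "(f ^^ k) holomorphic_on upper_half_plane"
      by (rule holomorphic_on_funpow[OF hol]) (use self in \<open>auto simp: upper_half_plane_def\<close>)
    have selfk: "Im ((f ^^ k) u) > 0" if "Im u > 0" for u by (rule Im_funpow_pos[OF self that])
    have pos: "Im \<i> > 0" "Im ((f ^^ k) \<i>) > 0" "Im ((f ^^ k) z) > 0" using z selfk by auto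
    have "c * (real k)\<^sup>2 \<le> hyp_gap \<i> ((f ^^ k) \<i>)" by (rule c)
    also have "\<dots> \<le> G * hyp_gap z ((f ^^ k) \<i>)"
      unfolding G_def by (intro hyp_gap_triangle pos z)
    also have "\<dots> \<le> G * (hyp_gap z ((f ^^ k) z) * hyp_gap ((f ^^ k) z) ((f ^^ k) \<i>))"
      using G by (intro mult_left_mono hyp_gap_triangle pos z) auto
    also have "hyp_gap ((f ^^ k) z) ((f ^^ k) \<i>) \<le> G"
      unfolding G_def by (subst hyp_gap_commute) (intro hyp_gap_contract holk selfk pos z)
    finally have "c * (real k)\<^sup>2 \<le> G * (hyp_gap z ((f ^^ k) z) * G)"
      using G hyp_gap_ge_4[OF z pos(3)] by (auto intro: mult_left_mono)
    thus ?thesis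
      using G c(1) by (simp add: power_mult_distrib power_divide field_simps power2_eq_square)
  qed
  moreover have "sqrt c / G > 0" using G c(1) by simp
  ultimately show ?thesis by blast
qed

section \<open>Backward orbits with bounded steps\<close>

text \<open>If the heights dropped by the factor \<open>1 + e\<close> in every block of
  \<open>L\<close> steps, the block displacements, being bounded by heights, would be summable, and
  \<open>w\<close> could not tend to infinity.\<close>

lemma backward_window:
  assumes pos: "\<And>n. Im (w n) > 0" and dec: "decseq (\<lambda>n. Im (w n))" and C: "C \<ge> 0"
    and step: "\<And>n. cmod (w n - w (Suc n)) \<le> C * Im (w n)"
    and inf: "filterlim w at_infinity sequentially"
    and L: "L \<ge> 1" and e: "e > 0"
  shows "\<exists>m. Im (w m) \<le> (1 + e) * Im (w (m + L))"
proof (rule ccontr)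
  assume "\<not> ?thesis"
  hence small: "(1 + e) * Im (w (m + L)) < Im (w m)" for m by (meson not_less)
  \<comment> \<open>A block starting at \<open>m\<close> loses at least the fraction
    \<open>e / (1 + e)\<close> of the height, so \<open>B\<close> times this loss dominates its
    displacement \<open>real L * C * Im (w m)\<close>.\<close>
  define B where "B = real L * C * (1 + e) / e"
  have B: "B \<ge> 0" "B * e = real L * C * (1 + e)" using C e by (auto simp: B_def)
  \<comment> \<open>The left side is a potential that no block increases; it replaces summing a
    geometric series.\<close>
  have bound: "cmod (w (j * L) - w 0) + B * Im (w (j * L)) \<le> B * Im (w 0)" for j
  proof (induction j)
    case (Suc j)
    define m where "m = j * L"
    have "cmod (w (m + L) - w 0) \<le> cmod (w (m + L) - w m) + cmod (w m - w 0)"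
      using norm_triangle_ineq[of "w (m + L) - w m" "w m - w 0"] by simp
    also have "cmod (w (m + L) - w m) \<le> real L * C * Im (w m)"
      by (rule displacement_le[OF dec C step, of m L])
    finally have 1: "cmod (w (m + L) - w 0) \<le> real L * C * Im (w m) + cmod (w m - w 0)"
      by simp
    have "real L * C * Im (w m) * (1 + e) = B * (e * Im (w m))"
      using B(2) by (simp add: mult_ac)
    also have "\<dots> \<le> B * ((Im (w m) - Im (w (m + L))) * (1 + e))"
      using B(1) small[of m] by (intro mult_left_mono) (auto simp: algebra_simps)
    finally have "real L * C * Im (w m) * (1 + e) \<le> B * (Im (w m) - Im (w (m + L))) * (1 + e)"
      by (simp only: mult.assoc)
    hence "real L * C * Im (w m) \<le> B * (Im (w m) - Im (w (m + L)))"
      by (rule mult_right_le_imp_le) (use e in simp)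
    with 1 Suc show ?case by (simp add: m_def algebra_simps)
  qed simp
  have "eventually (\<lambda>n. cmod (w 0) + B * Im (w 0) + 1 \<le> cmod (w n)) sequentially"
    using inf B(1) pos[of 0] unfolding filterlim_at_infinity[OF order_refl]
    by (auto simp: add_nonneg_pos)
  then obtain N where N: "\<And>n. n \<ge> N \<Longrightarrow> cmod (w 0) + B * Im (w 0) + 1 \<le> cmod (w n)"
    by (auto simp: eventually_sequentially)
  have "cmod (w (N * L)) \<le> cmod (w (N * L) - w 0) + cmod (w 0)"
    using norm_triangle_ineq[of "w (N * L) - w 0" "w 0"] by simp
  also have "cmod (w (N * L) - w 0) \<le> B * Im (w 0)"
    using bound[of N] mult_nonneg_nonneg[OF B(1) less_imp_le[OF pos[of "N * L"]]] by linarith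
  finally show False using N[of "N * L"] L by simp
qed

text \<open>Bounded hyperbolic steps are Euclidean steps comparable to the height: with
  \<open>A / Y\<close> as unknown, \<open>d^2 * (4 + A / Y) = A / Y\<close> is solved for
  it.\<close>

lemma cmod_diff_le_of_pseudo_hyp_dist_le:
  assumes z: "Im z > 0" and w: "Im w > 0" "Im w \<le> Im z"
    and a: "pseudo_hyp_dist z w \<le> a" "a < 1"
  shows "cmod (z - w) \<le> 2 / sqrt (1 - a\<^sup>2) * Im z"
proof -
  define d where "d = pseudo_hyp_dist z w"
  define A where "A = (cmod (z - w))\<^sup>2"
  define Y where "Y = Im z * Im w"
  have d: "0 \<le> d" "d \<le> a" using a by (auto simp: d_def pseudo_hyp_dist_def)
  hence a2: "1 - a\<^sup>2 > 0" using \<open>a < 1\<close> by (simp add: power_less_one_iff)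
  have Y: "Y > 0" "Y \<le> (Im z)\<^sup>2"
    using z w by (simp_all add: Y_def power2_eq_square mult_left_mono)
  have A: "A \<ge> 0" by (simp add: A_def)
  have "d\<^sup>2 * (4 + A / Y) = A / Y"
    using pseudo_hyp_dist_sq_eq[OF z w(1)] hyp_gap_eq[OF z w(1)]
    by (simp add: d_def A_def Y_def)
  moreover have "d\<^sup>2 * (4 + A / Y) \<le> a\<^sup>2 * (4 + A / Y)"
    using d A Y by (intro mult_right_mono power_mono) auto
  ultimately have "A / Y * (1 - a\<^sup>2) \<le> 4 * a\<^sup>2" by (simp add: algebra_simps)
  hence "A / Y * (1 - a\<^sup>2) \<le> 4" using a2 by linarith
  hence "A / Y \<le> 4 / (1 - a\<^sup>2)" using a2 by (simp only: pos_le_divide_eq)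
  hence "A \<le> 4 / (1 - a\<^sup>2) * Y" using Y by (simp only: pos_divide_le_eq)
  also have "\<dots> \<le> 4 / (1 - a\<^sup>2) * (Im z)\<^sup>2" using Y a2 by (intro mult_left_mono) simp_all
  also have "\<dots> = (2 / sqrt (1 - a\<^sup>2) * Im z)\<^sup>2"
    using a2 by (simp add: power_mult_distrib power_divide)
  finally show ?thesis
    unfolding A_def by (rule power2_le_imp_le) (use z a2 in simp)
qed

text \<open>As heights vanish, the horoball condition brings \<open>w j\<close> at least twice as
  close to \<open>cnj (P R)\<close> as \<open>w 0\<close> is, for large \<open>R\<close>. Comparing
  this for a fixed index \<open>J\<close> and for an arbitrary later \<open>j\<close> bounds
  \<open>w j\<close>.\<close>

lemma heights_not_tendsto_0:
  fixes w P :: "nat \<Rightarrow> complex"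
  assumes pos: "Im (w 0) > 0" and K: "K > 0" and inf: "filterlim w at_infinity sequentially"
    and ex: "\<And>j. \<exists>N. \<forall>R\<ge>N. (cmod (w j - cnj (P R)))\<^sup>2 * Im (w 0)
      \<le> K * Im (w j) * (cmod (w 0 - cnj (P R)))\<^sup>2"
  shows "\<not> (\<lambda>n. Im (w n)) \<longlonglongrightarrow> 0"
proof
  assume lim: "(\<lambda>n. Im (w n)) \<longlonglongrightarrow> 0"
  \<comment> \<open>The 4 becomes the ratio 2 of distances after taking a square root.\<close>
  have "0 < Im (w 0) / (4 * K)" using K pos by (intro divide_pos_pos mult_pos_pos) auto
  hence "eventually (\<lambda>n. Im (w n) < Im (w 0) / (4 * K)) sequentially"
    by (rule order_tendstoD(2)[OF lim])
  then obtain J where J: "\<And>n. n \<ge> J \<Longrightarrow> Im (w n) < Im (w 0) / (4 * K)"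
    unfolding eventually_sequentially by blast
  have half: "\<exists>N. \<forall>R\<ge>N. 2 * cmod (w j - cnj (P R)) \<le> cmod (w 0 - cnj (P R))"
    if "j \<ge> J" for j
  proof -
    obtain N where N: "\<And>R. R \<ge> N \<Longrightarrow> (cmod (w j - cnj (P R)))\<^sup>2 * Im (w 0)
        \<le> K * Im (w j) * (cmod (w 0 - cnj (P R)))\<^sup>2"
      using ex[of j] by blast
    have "2 * cmod (w j - cnj (P R)) \<le> cmod (w 0 - cnj (P R))" if "R \<ge> N" for R
    proof -
      have "K * Im (w j) \<le> Im (w 0) / 4"
        using J[OF \<open>j \<ge> J\<close>] K by (simp add: field_simps)
      hence "K * Im (w j) * (cmod (w 0 - cnj (P R)))\<^sup>2
          \<le> Im (w 0) / 4 * (cmod (w 0 - cnj (P R)))\<^sup>2"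
        by (rule mult_right_mono) simp
      with N[OF that] have "(2 * cmod (w j - cnj (P R)))\<^sup>2 * Im (w 0)
          \<le> (cmod (w 0 - cnj (P R)))\<^sup>2 * Im (w 0)"
        by (simp add: power_mult_distrib mult_ac)
      hence "(2 * cmod (w j - cnj (P R)))\<^sup>2 \<le> (cmod (w 0 - cnj (P R)))\<^sup>2"
        by (rule mult_right_le_imp_le) (rule pos)
      thus ?thesis by (rule power2_le_imp_le) simp
    qed
    thus ?thesis by blast
  qed
  have tri: "cmod (w i - cnj p) \<le> cmod (w i - w j) + cmod (w j - cnj p)" for i j p
    using norm_triangle_ineq[of "w i - w j" "w j - cnj p"] by simp
  define M where "M = cmod (w 0 - w J)"
  have bound: "cmod (w j - w 0) \<le> 3 * M" if j: "j \<ge> J" for j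
  proof -
    obtain N where N: "\<And>R. R \<ge> N \<Longrightarrow> 2 * cmod (w J - cnj (P R)) \<le> cmod (w 0 - cnj (P R))"
      using half[OF order_refl] by meson
    obtain N' where N': "\<And>R. R \<ge> N' \<Longrightarrow> 2 * cmod (w j - cnj (P R)) \<le> cmod (w 0 - cnj (P R))"
      using half[OF j] by meson
    \<comment> \<open>The index \<open>R\<close> may depend on \<open>j\<close>, but the bound does
      not: \<open>J\<close> gives \<open>cmod (w 0 - cnj p) \<le> 2 * M\<close>, and
      \<open>j\<close> adds at most half of that.\<close>
    define p where "p = P (max N N')"
    have "2 * cmod (w J - cnj p) \<le> cmod (w 0 - cnj p)"
      unfolding p_def by (rule N) simp
    moreover have "2 * cmod (w j - cnj p) \<le> cmod (w 0 - cnj p)"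
      unfolding p_def by (rule N') simp
    moreover have "cmod (w j - w 0) \<le> cmod (w j - cnj p) + cmod (w 0 - cnj p)"
      using norm_triangle_ineq4[of "w j - cnj p" "w 0 - cnj p"] by simp
    ultimately show ?thesis using tri[of 0 p J] by (simp add: M_def)
  qed
  have "eventually (\<lambda>n. 3 * M + cmod (w 0) + 1 \<le> cmod (w n)) sequentially"
    using inf unfolding filterlim_at_infinity[OF order_refl]
    by (auto simp: M_def add_nonneg_pos)
  then obtain N where N: "\<And>n. n \<ge> N \<Longrightarrow> 3 * M + cmod (w 0) + 1 \<le> cmod (w n)"
    by (auto simp: eventually_sequentially)
  have "cmod (w (max J N)) \<le> cmod (w (max J N) - w 0) + cmod (w 0)"
    using norm_triangle_ineq[of "w (max J N) - w 0" "w 0"] by simp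
  with bound[of "max J N"] N[of "max J N"] show False by simp
qed

section \<open>The points \<open>P R\<close> and the limit of the heights\<close>

theorem theorem1p21:
  fixes \<phi> :: "complex \<Rightarrow> complex" and w :: "nat \<Rightarrow> complex" and a :: real
  assumes "\<phi> holomorphic_on upper_half_plane"
    and "\<phi> ` upper_half_plane \<subseteq> upper_half_plane"
    and "nontangential_limit_at_infinity \<phi> at_infinity"
    and "nontangential_limit_at_infinity (\<lambda>z. \<phi> z / z) (nhds 1)"
    and "nonzero_step \<phi>"
    and "backward_iteration_sequence \<phi> w"
    and "filterlim w at_infinity sequentially"
    and "incseq (\<lambda>n. pseudo_hyp_dist (w n) (w (Suc n)))"
    and "(\<lambda>n. pseudo_hyp_dist (w n) (w (Suc n))) \<longlonglongrightarrow> a"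
    and "a < 1"
  shows "decseq (\<lambda>n. Im (w n)) \<and> (\<exists>l>0. (\<lambda>n. Im (w n)) \<longlonglongrightarrow> l)"
proof -
  have hol: "\<phi> holomorphic_on upper_half_plane" by fact
  have self: "Im (\<phi> z) > 0" if "Im z > 0" for z
    using assms(2) that by (auto simp: upper_half_plane_def)
  have inc: "Im (\<phi> z) \<ge> Im z" if "Im z > 0" for z
    by (rule Im_ge_of_tendsto_div[OF hol self assms(4) that])
  have pos: "Im (w n) > 0" and orbit: "\<phi> (w (Suc n)) = w n" for n
    using assms(6) by (auto simp: backward_iteration_sequence_def upper_half_plane_def)
  have dec: "decseq (\<lambda>n. Im (w n))"
    using inc[OF pos] by (intro decseq_SucI) (metis orbit)
  define C where "C = 2 / sqrt (1 - a\<^sup>2)"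
  have d: "pseudo_hyp_dist (w n) (w (Suc n)) \<le> a" for n
    using incseq_le[OF assms(8,9)] .
  have "0 \<le> a" using order_trans[OF _ d[of 0]] by (simp add: pseudo_hyp_dist_def)
  hence "a\<^sup>2 < 1" using \<open>a < 1\<close> by (simp add: power_less_one_iff)
  hence C: "C \<ge> 0" by (simp add: C_def)
  have step: "cmod (w n - w (Suc n)) \<le> C * Im (w n)" for n
    unfolding C_def
    by (rule cmod_diff_le_of_pseudo_hyp_dist_le[OF pos pos decseq_SucD[OF dec] d \<open>a < 1\<close>])
  obtain b where b: "b > 0" "\<And>k. hyp_gap (w 0) ((\<phi> ^^ k) (w 0)) \<ge> (b * real k)\<^sup>2"
    using orbit_gap_ge_square[OF hol self inc assms(5) pos] by blast
  \<comment> \<open>As \<open>hyp_gap\<close> is comparable to the exponential of the hyperbolic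
    distance, bounds linear in \<open>R\<close> stand for distances
    \<open>ln R + O(1)\<close>.\<close>
  have "\<exists>P. Im P > 0 \<and> b * real R \<le> 2 * (C + 2) * hyp_gap (w 0) P \<and>
      (\<forall>j\<le>R. hyp_gap (w j) P \<le> 2 * ((real j * C)\<^sup>2 + (real R + 1)\<^sup>2) / real R)"
    if R: "R \<ge> 1" for R
  proof -
    have iter: "(\<phi> ^^ k) (w (k + j)) = w j" for k j
      by (induction k arbitrary: j) (simp_all add: orbit funpow_swap1)
    txt \<open>Around \<open>n = m + R\<close> the heights are almost constant, so \<open>\<phi>\<close> is close to a horizontal translation
      at scale \<open>y\<close>. Hence \<open>\<phi> ^^ R\<close> moves the point \<open>q\<close>, which lies \<open>R\<close> times higher than \<open>w n\<close>, over
      a bounded hyperbolic distance, but moves \<open>w 0\<close> by about \<open>2 * ln R\<close>.\<close>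
    obtain m where m: "Im (w m) \<le> (1 + 1 / real R) * Im (w (m + 2 * R))"
      using backward_window[OF pos dec C step assms(7), of "2 * R" "1 / real R"] R by auto
    define n where "n = m + R"
    define y where "y = Im (w n)"
    define F where "F = \<phi> ^^ R"
    have holk: "(\<phi> ^^ k) holomorphic_on upper_half_plane" for k
      by (rule holomorphic_on_funpow[OF hol]) (use self in \<open>auto simp: upper_half_plane_def\<close>)
    have selfk: "Im ((\<phi> ^^ k) z) > 0" if "Im z > 0" for k z
      by (rule Im_funpow_pos[OF self that])
    have incF: "Im (F z) \<ge> Im z" if "Im z > 0" for z
      unfolding F_def by (rule Im_funpow_ge[OF self inc that])
    have y: "y > 0" by (simp add: y_def pos)
    have low: "Im (w (m + 2 * R)) \<le> y" using decseqD[OF dec] by (simp add: y_def n_def)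
    have high: "Im (w m) - y \<le> y / real R" "Im (w m) \<le> 2 * y" "y \<le> 2 * Im (w (m + 2 * R))"
    proof -
      have a: "Im (w (m + 2 * R)) / real R \<le> y / real R"
        using low by (intro divide_right_mono) auto
      have b: "u / real R \<le> u" if "u > 0" for u
        using R that by (simp add: field_simps)
      have c: "Im (w m) \<le> Im (w (m + 2 * R)) + Im (w (m + 2 * R)) / real R"
        using m by (simp add: algebra_simps)
      have d: "y \<le> Im (w m)" using decseqD[OF dec] by (simp add: y_def n_def)
      show "Im (w m) - y \<le> y / real R" "Im (w m) \<le> 2 * y" "y \<le> 2 * Im (w (m + 2 * R))"
        using a b[OF y] b[OF pos[of "m + 2 * R"]] c d low by linarith+
    qed
    define q where "q = w n + \<i> * of_real ((real R - 1) * y)"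
    have q: "Im q = real R * y" "Re q = Re (w n)"
      by (simp_all add: q_def y_def algebra_simps)
    have qpos: "Im q > 0" using q R y by simp
    \<comment> \<open>\<open>\<phi> ^^ n\<close> sends \<open>w (n + j)\<close> to
      \<open>w j\<close> and commutes with \<open>F\<close>, so the distances of \<open>q\<close> to
      these points and to \<open>F q\<close> bound those of \<open>P\<close> to \<open>w j\<close>
      and \<open>F P\<close>.\<close>
    define P where "P = (\<phi> ^^ n) q"
    have Ppos: "Im P > 0" unfolding P_def by (rule selfk[OF qpos])
    have near: "hyp_gap (w j) P \<le> 2 * ((real j * C)\<^sup>2 + (real R + 1)\<^sup>2) / real R" if "j \<le> R" for j
    proof -
      have "hyp_gap (w j) P \<le> hyp_gap (w (n + j)) q"
        using hyp_gap_contract[OF holk selfk pos qpos, of n "n + j"] by (simp add: P_def iter)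
      also have "\<dots> \<le> ((real j * C)\<^sup>2 + (real R + 1)\<^sup>2) * y\<^sup>2 / (y / 2 * (real R * y))"
        unfolding hyp_gap_def
      proof (rule frac_le)
        have "\<bar>Re (w (n + j)) - Re q\<bar> \<le> cmod (w (n + j) - w n)"
          using abs_Re_le_cmod[of "w (n + j) - w n"] by (simp add: q)
        also have "\<dots> \<le> real j * C * y"
          using displacement_le[OF dec C step, of n j] by (simp add: y_def)
        finally have "\<bar>Re (w (n + j)) - Re q\<bar>\<^sup>2 \<le> (real j * C * y)\<^sup>2"
          by (intro power_mono) auto
        moreover have "(Im (w (n + j)) + Im q)\<^sup>2 \<le> ((real R + 1) * y)\<^sup>2"
          using decseqD[OF dec, of n "n + j"] pos[of "n + j"] qpos
          by (intro power_mono) (auto simp: q y_def algebra_simps)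
        ultimately have "(cmod (w (n + j) - cnj q))\<^sup>2 \<le> (real j * C * y)\<^sup>2 + ((real R + 1) * y)\<^sup>2"
          unfolding cmod_power2 by simp
        also have "\<dots> = ((real j * C)\<^sup>2 + (real R + 1)\<^sup>2) * y\<^sup>2"
          by (simp add: power2_eq_square algebra_simps)
        finally show "(cmod (w (n + j) - cnj q))\<^sup>2 \<le> ((real j * C)\<^sup>2 + (real R + 1)\<^sup>2) * y\<^sup>2" .
        have "Im (w (m + 2 * R)) \<le> Im (w (n + j))"
          using that by (intro decseqD[OF dec]) (simp add: n_def)
        hence "y / 2 \<le> Im (w (n + j))" using high(3) by linarith
        thus "y / 2 * (real R * y) \<le> Im (w (n + j)) * Im q"
          unfolding q using y by (intro mult_right_mono) auto
      qed (use y R in auto)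
      also have "\<dots> = 2 * ((real j * C)\<^sup>2 + (real R + 1)\<^sup>2) / real R"
        using y R by (simp add: field_simps power2_eq_square)
      finally show ?thesis .
    qed
    have Fw: "F (w n) = w m" using iter[of R m] by (simp add: F_def n_def add.commute)
    define D where "D = cmod ((F q - q) - (F (w n) - w n))"
    have D: "D \<le> 2 * y"
    proof -
      \<comment> \<open>How far \<open>F\<close> raises \<open>q\<close> is known only up to
        \<open>y / R + D\<close>, so \<open>D\<close> occurs on both sides, and the resulting
        \<open>D^2 \<le> y * (y + D)\<close> is solved for it.\<close>
      have "D\<^sup>2 * (Im q * Im (w n)) \<le> (cmod (q - w n))\<^sup>2 * (Im (F q - q) * Im (F (w n) - w n))"
        unfolding D_def
        by (rule Schwarz_Pick_sq_closed[of "\<lambda>z. F z - z"])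
           (use holk[of R] incF pos qpos in \<open>auto simp: F_def intro!: holomorphic_intros\<close>)
      also have "\<dots> \<le> (real R * y)\<^sup>2 * ((y / real R + D) * (y / real R))"
      proof (intro mult_mono power_mono)
        have "cmod (q - w n) = \<bar>(real R - 1) * y\<bar>"
          by (simp add: q_def norm_mult del: of_real_mult of_real_diff)
        also have "\<dots> \<le> real R * y" using R y by (simp add: algebra_simps abs_mult)
        finally show "cmod (q - w n) \<le> real R * y" .
        show w: "Im (F (w n) - w n) \<le> y / real R" using high by (simp add: Fw y_def)
        have "Im ((F q - q) - (F (w n) - w n)) \<le> D"
          unfolding D_def using abs_Im_le_cmod abs_le_D1 by blast
        with w show "Im (F q - q) \<le> y / real R + D" by simp
      qed (use y incF qpos pos in \<open>auto simp: D_def\<close>)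
      also have "\<dots> = (y * (y / real R + D)) * (real R * y\<^sup>2)"
        using R by (simp add: power2_eq_square field_simps)
      also have "Im q * Im (w n) = real R * y\<^sup>2"
        by (simp add: q y_def power2_eq_square)
      finally have "D\<^sup>2 * (real R * y\<^sup>2) \<le> (y * (y / real R + D)) * (real R * y\<^sup>2)" .
      hence "D\<^sup>2 \<le> y * (y / real R + D)"
        by (rule mult_right_le_imp_le) (use R y in auto)
      also have "\<dots> \<le> y * (y + D)" using R y by (simp add: field_simps)
      finally have *: "D\<^sup>2 \<le> y * (y + D)" .
      show ?thesis
      proof (rule ccontr)
        assume "\<not> ?thesis"
        hence "D > 2 * y" by simp
        hence "0 < (D - 2 * y) * (D + y)" using y by (intro mult_pos_pos) auto
        moreover have "0 < y * y" using y by simp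
        ultimately show False using * by (simp add: power2_eq_square algebra_simps)
      qed
    qed
    have "cmod (F q - q) \<le> 2 * real R * (C + 1) * y"
    proof -
      have "cmod (F q - q) \<le> D + cmod (F (w n) - w n)"
        unfolding D_def using norm_triangle_ineq[of "(F q - q) - (F (w n) - w n)" "F (w n) - w n"]
        by simp
      also have "cmod (F (w n) - w n) \<le> real R * C * Im (w m)"
        using displacement_le[OF dec C step, of m R]
        unfolding Fw unfolding n_def by (simp add: norm_minus_commute)
      also have "\<dots> \<le> real R * C * (2 * y)" using high C by (intro mult_left_mono) auto
      also have "D \<le> 2 * real R * y" using D R y mult_right_mono[of 1 "real R" y] by linarith
      finally show ?thesis by (simp add: algebra_simps)
    qed
    hence "cmod (q - cnj (F q)) \<le> 2 * real R * y + 2 * real R * (C + 1) * y"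
    proof -
      assume a: "cmod (F q - q) \<le> 2 * real R * (C + 1) * y"
      have "cmod (q - cnj (F q)) \<le> cmod (q - cnj q) + cmod (cnj (F q - q))"
        using norm_triangle_ineq4[of "q - cnj q" "cnj (F q - q)"] by simp
      also have "cmod (q - cnj q) = 2 * real R * y"
        using q y by (simp add: complex_diff_cnj norm_mult)
      finally show ?thesis using a by (simp only: complex_mod_cnj)
    qed
    hence "cmod (q - cnj (F q)) \<le> 2 * (C + 2) * (real R * y)" by (simp add: algebra_simps)
    hence "(cmod (q - cnj (F q)))\<^sup>2 \<le> (2 * (C + 2) * (real R * y))\<^sup>2" by (intro power_mono) auto
    moreover have "(real R * y)\<^sup>2 \<le> Im q * Im (F q)"
      using incF[OF qpos] qpos unfolding power2_eq_square q by (intro mult_left_mono) auto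
    ultimately have "hyp_gap q (F q) \<le> (2 * (C + 2) * (real R * y))\<^sup>2 / (real R * y)\<^sup>2"
      unfolding hyp_gap_def using R y by (intro frac_le) auto
    also have "\<dots> = (2 * (C + 2))\<^sup>2" using R y by (simp add: power_mult_distrib)
    finally have qF: "hyp_gap q (F q) \<le> (2 * (C + 2))\<^sup>2" .
    have comm: "F P = (\<phi> ^^ n) (F q)"
      unfolding F_def P_def by (metis add.commute comp_apply funpow_add)
    \<comment> \<open>The path from \<open>w 0\<close> over \<open>P\<close> and \<open>F P\<close>
      to \<open>F (w 0)\<close> must be long, while its middle piece is bounded and its last is no
      longer than its first; so the first takes at least half the length, up to a constant.\<close>
    have "(b * real R)\<^sup>2 \<le> hyp_gap (w 0) (F (w 0))" using b(2)[of R] by (simp add: F_def)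
    also have "\<dots> \<le> hyp_gap (w 0) P * hyp_gap P (F (w 0))"
      using pos Ppos selfk by (intro hyp_gap_triangle) (auto simp: F_def)
    also have "\<dots> \<le> hyp_gap (w 0) P * (hyp_gap P (F P) * hyp_gap (F P) (F (w 0)))"
      using pos Ppos selfk hyp_gap_ge_4[of "w 0" P]
      by (intro mult_left_mono hyp_gap_triangle) (auto simp: F_def)
    also have "\<dots> \<le> hyp_gap (w 0) P * ((2 * (C + 2))\<^sup>2 * hyp_gap (w 0) P)"
    proof (intro mult_left_mono mult_mono)
      have "hyp_gap P (F P) \<le> hyp_gap q (F q)"
        unfolding comm unfolding P_def F_def by (intro hyp_gap_contract holk selfk qpos)
      with qF show "hyp_gap P (F P) \<le> (2 * (C + 2))\<^sup>2" by linarith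
      show "hyp_gap (F P) (F (w 0)) \<le> hyp_gap (w 0) P"
        unfolding F_def using hyp_gap_contract[OF holk selfk Ppos pos] by (metis hyp_gap_commute)
      show "0 \<le> hyp_gap (w 0) P" using hyp_gap_ge_4[OF pos[of 0] Ppos] by simp
      have "Im (F P) > 0" "Im (F (w 0)) > 0" using Ppos pos selfk by (auto simp: F_def)
      from hyp_gap_ge_4[OF this] show "0 \<le> hyp_gap (F P) (F (w 0))" by simp
    qed auto
    also have "\<dots> = (2 * (C + 2) * hyp_gap (w 0) P)\<^sup>2" by (simp add: power2_eq_square mult_ac)
    finally have "b * real R \<le> 2 * (C + 2) * hyp_gap (w 0) P"
      by (rule power2_le_imp_le) (use hyp_gap_ge_4[OF pos[of 0] Ppos] C in auto)
    with Ppos near show ?thesis by blast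
  qed
  then obtain P where P: "\<And>R. R \<ge> 1 \<Longrightarrow> Im (P R) > 0"
      "\<And>R. R \<ge> 1 \<Longrightarrow> b * real R \<le> 2 * (C + 2) * hyp_gap (w 0) (P R)"
      "\<And>R j. R \<ge> 1 \<Longrightarrow> j \<le> R \<Longrightarrow>
        hyp_gap (w j) (P R) \<le> 2 * ((real j * C)\<^sup>2 + (real R + 1)\<^sup>2) / real R"
    by metis
  \<comment> \<open>This is \<open>10 / b\<close> times \<open>2 * (C + 2)\<close>: the 10 bounds
    the gaps to \<open>w j\<close> below, the rest comes from the lower bound for the gap to
    \<open>w 0\<close>.\<close>
  define K where "K = 20 * (C + 2) / b"
  have K: "K > 0" using b C by (simp add: K_def)
  have ex: "\<exists>N. \<forall>R\<ge>N. (cmod (w j - cnj (P R)))\<^sup>2 * Im (w 0)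
      \<le> K * Im (w j) * (cmod (w 0 - cnj (P R)))\<^sup>2" for j
  proof (intro exI allI impI)
    \<comment> \<open>Once \<open>R\<close> exceeds \<open>j * C\<close>, the numerator is at most
      \<open>2 * (R^2 + 4 * R^2)\<close>, a bound free of \<open>j\<close>.\<close>
    fix R assume R: "max 1 (max j (nat \<lceil>real j * C\<rceil>)) \<le> R"
    hence R1: "R \<ge> 1" "j \<le> R" by auto
    have "nat \<lceil>real j * C\<rceil> \<le> R" using R by simp
    hence "(real j * C)\<^sup>2 \<le> (real R)\<^sup>2"
      using C by (intro power_mono) (auto simp: nat_le_iff ceiling_le_iff)
    moreover have "(real R + 1)\<^sup>2 \<le> (2 * real R)\<^sup>2" using R1 by (intro power_mono) auto
    ultimately have "2 * ((real j * C)\<^sup>2 + (real R + 1)\<^sup>2) \<le> 10 * real R * real R"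
      by (simp add: power2_eq_square)
    hence "2 * ((real j * C)\<^sup>2 + (real R + 1)\<^sup>2) / real R \<le> 10 * real R"
      using R1 by (simp add: pos_divide_le_eq)
    with P(3)[OF R1] have "hyp_gap (w j) (P R) \<le> 10 * real R" by linarith
    also have "\<dots> = 10 / b * (b * real R)" using b by simp
    also have "\<dots> \<le> 10 / b * (2 * (C + 2) * hyp_gap (w 0) (P R))"
      using b P(2)[OF R1(1)] by (intro mult_left_mono) auto
    finally have "hyp_gap (w j) (P R) \<le> K * hyp_gap (w 0) (P R)" by (simp add: K_def mult_ac)
    thus "(cmod (w j - cnj (P R)))\<^sup>2 * Im (w 0) \<le> K * Im (w j) * (cmod (w 0 - cnj (P R)))\<^sup>2"
      using P(1)[OF R1(1)] pos[of 0] pos[of j] by (simp add: hyp_gap_def field_simps)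
  qed
  obtain l where l: "(\<lambda>n. Im (w n)) \<longlonglongrightarrow> l"
    using decseq_convergent[OF dec, of 0] pos less_imp_le by metis
  have "l \<ge> 0" using l pos by (intro LIMSEQ_le_const[OF l]) (auto simp: less_imp_le)
  moreover have "l \<noteq> 0"
    using heights_not_tendsto_0[OF pos K assms(7) ex] l by metis
  ultimately have "l > 0" by simp
  with dec l show ?thesis by (intro conjI exI[of _ l])
qed

end
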